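(* Let $G$ be a strongly topological gyrogroup and let $H$ be a closed first-countable and separable strong subgyrogroup of $G$. If the quotient space $G/H$ has a star-countable $wcs^{*}$-network, then $G$ also has a star-countable $wcs^{*}$-network.
   Context: All topological spaces are assumed Hausdorff. A gyrogroup is a nonempty set $G$ with a binary operation $\oplus$ such that: (G1) there is a unique $0\in G$ with $0\oplus a=a=a\oplus 0$ for all $a$; (G2) each $x\in G$ has a unique inverse $\ominus x$ with $\ominus x\oplus x=0=x\oplus(\ominus x)$; (G3) for all $x,y\in G$ there is an automorphism $\mathrm{gyr}[x,y]$ of $(G,\oplus)$ with $x\oplus(y\oplus z)=(x\oplus y)\oplus\mathrm{gyr}[x,y](z)$ for all $z\in G$; (G4) $\mathrm{gyr}[x\oplus y,y]=\mathrm{gyr}[x,y]$ for all $x,y\in G$. A topological gyrogroup is a gyrogroup with a topology making $\oplus:G\times G\to G$ jointly continuous and $x\mapsto\ominus x$ continuous. It is a strongly topological gyrogroup if there is a neighborhood base $\mathscr U$ of $0$ with $\mathrm{gyr}[x,y](U)=U$ for all $U\in\mathscr U$ and $x,y\in G$. A subgyrogroup is a nonempty subset $H\subseteq G$ that is a gyrogroup under the inherited operation and such that $\mathrm{gyr}[a,b]$ restricts to an automorphism of $H$ for all $a,b\in H$. It is a strong subgyrogroup if $\mathrm{gyr}[x,y](H)=H$ for all $x,y\in G$. For such $H$ the left cosets $a\oplus H$ ($a\in G$) partition $G$; $G/H=\{a\oplus H:a\in G\}$ carries the quotient topology induced by $\pi:G\to G/H$, $\pi(a)=a\oplus H$. Subgyrogroups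 carry the subspace topology. A family $\mathcal P$ of subsets of a space $X$ is a $wcs^{*}$-network for $X$ if, given a sequence $\{x_n\}_n$ converging to a point $x$ in $X$ and a neighborhood $U$ of $x$, there is a subsequence $\{x_{n_i}\}_i$ with $\{x_{n_i}:i\in\mathbb N\}\subseteq P\subseteq U$ for some $P\in\mathcal P$. A family $\mathcal P$ of sets is star-countable if each $P\in\mathcal P$ meets at most countably many members of $\mathcal P$. *)

theory Defs
  imports "HOL-Analysis.Analysis"
begin

section \<open>Gyrogroups\<close>

definition automorphism_on :: "'a set \<Rightarrow> ('a \<Rightarrow> 'a \<Rightarrow> 'a) \<Rightarrow> ('a \<Rightarrow> 'a) \<Rightarrow> bool" where
  "automorphism_on G add f \<longleftrightarrow>
     bij_betw f G G \<and> (\<forall>x\<in>G. \<forall>y\<in>G. f (add x y) = add (f x) (f y))"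

text \<open>The operations are only constrained on the carrier \<open>G\<close>; in particular (G4) is equality
  of the two gyrations as maps on \<open>G\<close>.\<close>

locale gyrogroup =
  fixes G :: "'a set"
    and add :: "'a \<Rightarrow> 'a \<Rightarrow> 'a"
    and zero :: 'a
    and neg :: "'a \<Rightarrow> 'a"
    and gyr :: "'a \<Rightarrow> 'a \<Rightarrow> 'a \<Rightarrow> 'a"
  assumes add_closed: "x \<in> G \<Longrightarrow> y \<in> G \<Longrightarrow> add x y \<in> G"
    and zero_closed: "zero \<in> G"
    and add_zero_left: "x \<in> G \<Longrightarrow> add zero x = x"
    and add_zero_right: "x \<in> G \<Longrightarrow> add x zero = x"
    and zero_unique: "e \<in> G \<Longrightarrow> (\<And>x. x \<in> G \<Longrightarrow> add e x = x \<and> add x e = x) \<Longrightarrow> e = zero"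
    and neg_closed: "x \<in> G \<Longrightarrow> neg x \<in> G"
    and add_neg_left: "x \<in> G \<Longrightarrow> add (neg x) x = zero"
    and add_neg_right: "x \<in> G \<Longrightarrow> add x (neg x) = zero"
    and neg_unique: "x \<in> G \<Longrightarrow> y \<in> G \<Longrightarrow> add y x = zero \<Longrightarrow> add x y = zero \<Longrightarrow> y = neg x"
    and gyr_automorphism: "x \<in> G \<Longrightarrow> y \<in> G \<Longrightarrow> automorphism_on G add (gyr x y)"
    and gyr_assoc: "x \<in> G \<Longrightarrow> y \<in> G \<Longrightarrow> z \<in> G \<Longrightarrow>
          add x (add y z) = add (add x y) (gyr x y z)"
    and gyr_loop: "x \<in> G \<Longrightarrow> y \<in> G \<Longrightarrow> z \<in> G \<Longrightarrow> gyr (add x y) y z = gyr x y z"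

definition subgyrogroup ::
  "'a set \<Rightarrow> ('a \<Rightarrow> 'a \<Rightarrow> 'a) \<Rightarrow> ('a \<Rightarrow> 'a \<Rightarrow> 'a \<Rightarrow> 'a) \<Rightarrow> 'a set \<Rightarrow> bool" where
  "subgyrogroup G add gyr H \<longleftrightarrow>
     H \<noteq> {} \<and> H \<subseteq> G \<and>
     (\<exists>zero' neg' gyr'. gyrogroup H add zero' neg' gyr') \<and>
     (\<forall>a\<in>H. \<forall>b\<in>H. automorphism_on H add (gyr a b))"

definition strong_subgyrogroup ::
  "'a set \<Rightarrow> ('a \<Rightarrow> 'a \<Rightarrow> 'a) \<Rightarrow> ('a \<Rightarrow> 'a \<Rightarrow> 'a \<Rightarrow> 'a) \<Rightarrow> 'a set \<Rightarrow> bool" where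
  "strong_subgyrogroup G add gyr H \<longleftrightarrow>
     subgyrogroup G add gyr H \<and> (\<forall>x\<in>G. \<forall>y\<in>G. gyr x y ` H = H)"

definition left_coset :: "('a \<Rightarrow> 'a \<Rightarrow> 'a) \<Rightarrow> 'a set \<Rightarrow> 'a \<Rightarrow> 'a set" where
  "left_coset add H a = add a ` H"


section \<open>Topological gyrogroups\<close>

definition neighborhood :: "'a topology \<Rightarrow> 'a \<Rightarrow> 'a set \<Rightarrow> bool" where
  "neighborhood X x U \<longleftrightarrow> U \<subseteq> topspace X \<and> (\<exists>W. openin X W \<and> x \<in> W \<and> W \<subseteq> U)"

definition neighborhood_base :: "'a topology \<Rightarrow> 'a \<Rightarrow> 'a set set \<Rightarrow> bool" where
  "neighborhood_base X x \<U> \<longleftrightarrow>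
     (\<forall>U\<in>\<U>. neighborhood X x U) \<and> (\<forall>N. neighborhood X x N \<longrightarrow> (\<exists>U\<in>\<U>. U \<subseteq> N))"

text \<open>The Hausdorff condition is included since all spaces are assumed Hausdorff.\<close>

locale topological_gyrogroup = gyrogroup "topspace T" add zero neg gyr
  for T :: "'a topology" and add zero neg gyr +
  assumes hausdorff: "Hausdorff_space T"
    and continuous_add: "continuous_map (prod_topology T T) T (\<lambda>(x, y). add x y)"
    and continuous_neg: "continuous_map T T neg"

locale strongly_topological_gyrogroup = topological_gyrogroup T add zero neg gyr
  for T :: "'a topology" and add zero neg gyr +
  assumes gyr_invariant_base:
    "\<exists>\<U>. neighborhood_base T zero \<U> \<and>
         (\<forall>U\<in>\<U>. \<forall>x\<in>topspace T. \<forall>y\<in>topspace T. gyr x y ` U = U)"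


section \<open>Quotient topology\<close>

definition quotient_topology :: "'a topology \<Rightarrow> ('a \<Rightarrow> 'b) \<Rightarrow> 'b topology" where
  "quotient_topology X f =
     topology (\<lambda>V. V \<subseteq> f ` topspace X \<and> openin X {x \<in> topspace X. f x \<in> V})"

lemma openin_quotient_topology:
  "openin (quotient_topology X f) V \<longleftrightarrow>
     V \<subseteq> f ` topspace X \<and> openin X {x \<in> topspace X. f x \<in> V}"
proof -
  have "istopology (\<lambda>V. V \<subseteq> f ` topspace X \<and> openin X {x \<in> topspace X. f x \<in> V})"
    unfolding istopology_def
  proof (intro conjI allI impI)
    fix S T
    assume S: "S \<subseteq> f ` topspace X \<and> openin X {x \<in> topspace X. f x \<in> S}"
      and T: "T \<subseteq> f ` topspace X \<and> openin X {x \<in> topspace X. f x \<in> T}"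
    show "S \<inter> T \<subseteq> f ` topspace X" using S by blast
    have "{x \<in> topspace X. f x \<in> S \<inter> T} =
        {x \<in> topspace X. f x \<in> S} \<inter> {x \<in> topspace X. f x \<in> T}" by blast
    then show "openin X {x \<in> topspace X. f x \<in> S \<inter> T}"
      using S T by (simp only: openin_Int)
  next
    fix K
    assume K: "\<forall>S\<in>K. S \<subseteq> f ` topspace X \<and> openin X {x \<in> topspace X. f x \<in> S}"
    then show "\<Union>K \<subseteq> f ` topspace X" by blast
    have "{x \<in> topspace X. f x \<in> \<Union>K} = (\<Union>S\<in>K. {x \<in> topspace X. f x \<in> S})" by blast
    then show "openin X {x \<in> topspace X. f x \<in> \<Union>K}"
      using K by (auto intro: openin_Union)
  qed
  then show ?thesis
    unfolding quotient_topology_def by (simp only: topology_inverse')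
qed

lemma topspace_quotient_topology: "topspace (quotient_topology X f) = f ` topspace X"
proof -
  have "{x \<in> topspace X. f x \<in> f ` topspace X} = topspace X" by blast
  then have "openin (quotient_topology X f) (f ` topspace X)"
    unfolding openin_quotient_topology by simp
  then have "f ` topspace X \<subseteq> topspace (quotient_topology X f)"
    by (rule openin_subset)
  moreover have "topspace (quotient_topology X f) \<subseteq> f ` topspace X"
    using openin_topspace[of "quotient_topology X f"]
    unfolding openin_quotient_topology by (rule conjunct1)
  ultimately show ?thesis by (rule subset_antisym[rotated])
qed

lemma quotient_map_quotient_topology: "quotient_map X (quotient_topology X f) f"
  unfolding quotient_map_def topspace_quotient_topology openin_quotient_topology by blast

text \<open>The space \<open>G/H\<close> of left cosets.\<close>

definition coset_space :: "'a topology \<Rightarrow> ('a \<Rightarrow> 'a \<Rightarrow> 'a) \<Rightarrow> 'a set \<Rightarrow> 'a set topology" where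
  "coset_space T add H = quotient_topology T (left_coset add H)"


section \<open>Networks\<close>

definition wcs_star_network :: "'a topology \<Rightarrow> 'a set set \<Rightarrow> bool" where
  "wcs_star_network X \<P> \<longleftrightarrow>
     (\<forall>P\<in>\<P>. P \<subseteq> topspace X) \<and>
     (\<forall>s x U. range s \<subseteq> topspace X \<longrightarrow> limitin X s x sequentially \<longrightarrow> neighborhood X x U \<longrightarrow>
        (\<exists>r :: nat \<Rightarrow> nat. strict_mono r \<and> (\<exists>P\<in>\<P>. range (s \<circ> r) \<subseteq> P \<and> P \<subseteq> U)))"

definition star_countable :: "'a set set \<Rightarrow> bool" where
  "star_countable \<P> \<longleftrightarrow> (\<forall>P\<in>\<P>. countable {Q \<in> \<P>. P \<inter> Q \<noteq> {}})"

end

theory Submission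
  imports Defs
begin

text \<open>
  Gyration-invariant neighborhoods \<open>V\<close> of \<open>0\<close> make the relations \<open>y \<in> x \<oplus> V\<close> the entourages of
  a uniformity on \<open>G\<close>, so that the nonassociativity of \<open>\<oplus>\<close> disappears from all estimates. Let
  \<open>V\<^sub>k\<close> be invariant neighborhoods whose traces form a base of \<open>H\<close> at \<open>0\<close>, and let \<open>D\<close> be
  countable and dense in \<open>H\<close>. For each member \<open>P\<close> of the network of \<open>G/H\<close> fix one point \<open>a\<^sub>P\<close>
  over \<open>P\<close>; the sets \<open>\<pi>\<^sup>-\<^sup>1(P) \<inter> ((a\<^sub>P \<oplus> d) \<oplus> V\<^sub>k)\<close> with \<open>d \<in> D\<close> are star-countable because each \<open>P\<close>
  contributes countably many. If \<open>P \<subseteq> \<pi>(x \<oplus> W)\<close>, then some \<open>a\<^sub>P \<oplus> d\<close> is close to \<open>x\<close>, so the set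
  captures the points of \<open>\<pi>\<^sup>-\<^sup>1(P)\<close> close to \<open>x\<close>; conversely its points \<open>(x \<oplus> w) \<oplus> h\<close> have
  \<open>h \<in> H\<close> close to \<open>0\<close> in \<open>H\<close>, and hence lie close to \<open>x\<close>.
\<close>

section \<open>Gyrogroup algebra: left cancellation and subgyrogroups\<close>

context gyrogroup
begin

lemma gyr_closed: "x \<in> G \<Longrightarrow> y \<in> G \<Longrightarrow> z \<in> G \<Longrightarrow> gyr x y z \<in> G"
  using gyr_automorphism[of x y] by (auto simp: automorphism_on_def dest: bij_betwE)

lemma gyr_inj: "x \<in> G \<Longrightarrow> y \<in> G \<Longrightarrow> u \<in> G \<Longrightarrow> v \<in> G \<Longrightarrow> gyr x y u = gyr x y v \<Longrightarrow> u = v"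
  using gyr_automorphism[of x y] by (auto simp: automorphism_on_def bij_betw_def dest: inj_onD)

lemma neg_add_gyr:
  assumes "a \<in> G" "b \<in> G"
  shows "add (neg a) (add a b) = gyr (neg a) a b"
  using assms gyr_assoc[of "neg a" a b]
  by (simp add: neg_closed add_neg_left add_zero_left gyr_closed)

lemma add_left_inj:
  assumes "a \<in> G" "b \<in> G" "c \<in> G" "add a b = add a c"
  shows "b = c"
  using assms neg_add_gyr gyr_inj neg_closed by metis

lemma gyr_zero_left:
  assumes "a \<in> G" "c \<in> G"
  shows "gyr zero a c = c"
proof -
  have "add a (gyr zero a c) = add a c"
    using gyr_assoc[OF zero_closed assms] assms
    by (simp add: add_zero_left add_closed)
  then show ?thesis
    using add_left_inj[OF assms(1)] gyr_closed zero_closed assms by blast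
qed

text \<open>The loop property (G4) trades \<open>gyr (neg a) a\<close> for
  \<open>gyr (add (neg a) a) a\<close>, that is \<open>gyr zero a\<close>, which is the identity; so
  the gyration left over in \<open>neg_add_gyr\<close> disappears.\<close>

lemma neg_add_cancel:
  assumes "a \<in> G" "b \<in> G"
  shows "add (neg a) (add a b) = b"
proof -
  have "gyr (neg a) a b = gyr zero a b"
    using gyr_loop[of "neg a" a b] assms by (simp add: neg_closed add_neg_left)
  then show ?thesis
    using assms by (simp add: neg_add_gyr gyr_zero_left)
qed

lemma neg_neg: "a \<in> G \<Longrightarrow> neg (neg a) = a"
  using neg_unique[of "neg a" a] add_neg_left add_neg_right neg_closed by metis

lemma add_neg_cancel:
  assumes "a \<in> G" "b \<in> G"
  shows "add a (add (neg a) b) = b"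
  using neg_add_cancel[of "neg a" b] assms by (simp add: neg_closed neg_neg)

text \<open>An invariant set absorbs the gyration in \<open>gyr_assoc\<close>, so sums can be
  reassociated as long as only membership of the last term matters. It serves both for
  \<open>H\<close> (cosets) and for invariant neighborhoods.\<close>

lemma add_assoc_invariant:
  assumes "x \<in> G" "y \<in> G" "V \<subseteq> G" "gyr x y ` V = V" "v \<in> V"
  obtains v' where "v' \<in> V" "add (add x y) v = add x (add y v')"
proof -
  obtain v' where "v' \<in> V" "v = gyr x y v'" using assms by blast
  then show ?thesis using that gyr_assoc[of x y v'] assms by auto
qed

text \<open>A subgyrogroup comes with its own neutral element. This element is idempotent in
  \<open>G\<close>, hence equals \<open>zero\<close> by left cancellation.\<close>

lemma zero_mem_subgyrogroup:
  assumes "subgyrogroup G add gyr H"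
  shows "zero \<in> H"
proof -
  from assms obtain z n g where gg: "gyrogroup H add z n g" and HG: "H \<subseteq> G"
    unfolding subgyrogroup_def by blast
  interpret K: gyrogroup H add z n g by (fact gg)
  have z: "z \<in> H" "z \<in> G" using K.zero_closed HG by auto
  have "add z z = add z zero"
    using K.add_zero_left[OF z(1)] add_zero_right[OF z(2)] by simp
  then have "z = zero" using add_left_inj z zero_closed by blast
  then show ?thesis using z by simp
qed

lemma neg_mem_subgyrogroup:
  assumes H: "subgyrogroup G add gyr H" and h: "h \<in> H"
  shows "neg h \<in> H"
proof -
  from H obtain z n g where gg: "gyrogroup H add z n g" and HG: "H \<subseteq> G"
    unfolding subgyrogroup_def by blast
  interpret K: gyrogroup H add z n g by (fact gg)
  have n: "n h \<in> H" using K.neg_closed h .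
  have "z = zero"
    using K.zero_unique[OF zero_mem_subgyrogroup[OF H]] add_zero_left add_zero_right HG by blast
  then have "n h = neg h"
    using neg_unique[of h "n h"] K.add_neg_left[OF h] K.add_neg_right[OF h] n h HG by auto
  then show ?thesis using n by simp
qed

lemma add_mem_subgyrogroup:
  assumes "subgyrogroup G add gyr H" "h \<in> H" "k \<in> H"
  shows "add h k \<in> H"
  using assms unfolding subgyrogroup_def by (meson gyrogroup.add_closed)

section \<open>Left cosets of a strong subgyrogroup\<close>

context
  fixes H assumes H: "strong_subgyrogroup G add gyr H"
begin

lemma subgyrogroup_of_strong: "subgyrogroup G add gyr H"
  using H by (simp add: strong_subgyrogroup_def)

lemma strong_subgyrogroup_subset: "H \<subseteq> G"
  using subgyrogroup_of_strong by (simp add: subgyrogroup_def)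

lemma strong_subgyrogroup_gyr: "x \<in> G \<Longrightarrow> y \<in> G \<Longrightarrow> gyr x y ` H = H"
  using H by (simp add: strong_subgyrogroup_def)

lemma left_coset_self: "a \<in> G \<Longrightarrow> a \<in> left_coset add H a"
  using zero_mem_subgyrogroup[OF subgyrogroup_of_strong] add_zero_right
  unfolding left_coset_def by (metis image_eqI)

lemma left_coset_subset:
  assumes a: "a \<in> G" and b: "b \<in> left_coset add H a"
  shows "left_coset add H b \<subseteq> left_coset add H a"
proof
  obtain h where h: "h \<in> H" "b = add a h" using b by (auto simp: left_coset_def)
  fix y assume "y \<in> left_coset add H b"
  then obtain k where k: "k \<in> H" "y = add (add a h) k" using h by (auto simp: left_coset_def)
  have hG: "h \<in> G" using h strong_subgyrogroup_subset by blast
  obtain k' where "k' \<in> H" "y = add a (add h k')"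
    using add_assoc_invariant[OF a hG strong_subgyrogroup_subset strong_subgyrogroup_gyr[OF a hG] k(1)]
      k(2) by metis
  then show "y \<in> left_coset add H a"
    using add_mem_subgyrogroup[OF subgyrogroup_of_strong h(1)] by (auto simp: left_coset_def)
qed

text \<open>The way back from \<open>add a h\<close> to \<open>a\<close> is not \<open>neg h\<close>
  but its image \<open>gyr a h (neg h)\<close>, which stays in \<open>H\<close> because
  \<open>H\<close> is invariant.\<close>

lemma left_coset_sym:
  assumes a: "a \<in> G" and b: "b \<in> left_coset add H a"
  shows "a \<in> left_coset add H b"
proof -
  obtain h where h: "h \<in> H" "b = add a h" using b by (auto simp: left_coset_def)
  have hG: "h \<in> G" using h strong_subgyrogroup_subset by blast
  have "gyr a h (neg h) \<in> H"
    using strong_subgyrogroup_gyr[OF a hG] neg_mem_subgyrogroup[OF subgyrogroup_of_strong h(1)]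
    by blast
  moreover have "add b (gyr a h (neg h)) = a"
    using gyr_assoc[OF a hG neg_closed[OF hG]] a hG h by (simp add: add_neg_right add_zero_right)
  ultimately show ?thesis unfolding left_coset_def by (metis image_eqI)
qed

lemma left_coset_eq_iff:
  assumes a: "a \<in> G" and b: "b \<in> G"
  shows "left_coset add H a = left_coset add H b \<longleftrightarrow> b \<in> left_coset add H a"
proof
  assume "left_coset add H a = left_coset add H b"
  then show "b \<in> left_coset add H a" using left_coset_self[OF b] by simp
next
  assume ba: "b \<in> left_coset add H a"
  then have ab: "a \<in> left_coset add H b" using left_coset_sym[OF a] by simp
  show "left_coset add H a = left_coset add H b"
    using left_coset_subset[OF a ba] left_coset_subset[OF b ab] by (rule subset_antisym[rotated])
qed

end

end

section \<open>Translations and openness of the coset projection\<close>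

context topological_gyrogroup
begin

lemma continuous_add_left:
  assumes "a \<in> topspace T"
  shows "continuous_map T T (add a)"
proof -
  have "continuous_map T (prod_topology T T) (\<lambda>x. (a, x))"
    using assms by (intro continuous_map_pairedI) auto
  from continuous_map_compose[OF this continuous_add] show ?thesis
    by (simp add: o_def)
qed

lemma continuous_add_right:
  assumes "a \<in> topspace T"
  shows "continuous_map T T (\<lambda>x. add x a)"
proof -
  have "continuous_map T (prod_topology T T) (\<lambda>x. (x, a))"
    using assms by (intro continuous_map_pairedI) auto
  from continuous_map_compose[OF this continuous_add] show ?thesis
    by (simp add: o_def)
qed

lemma neighborhood_preimage_left_translation:
  assumes x: "x \<in> topspace T" and N: "neighborhood T zero N"
  obtains O' where "openin T O'" "x \<in> O'" "O' \<subseteq> add x ` N"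
proof -
  obtain W where W: "openin T W" "zero \<in> W" "W \<subseteq> N" using N by (auto simp: neighborhood_def)
  let ?O = "{y \<in> topspace T. add (neg x) y \<in> W}"
  have "openin T ?O"
    using openin_continuous_map_preimage[OF continuous_add_left[OF neg_closed[OF x]] W(1)] .
  moreover have "x \<in> ?O" using x W by (simp add: add_neg_left)
  moreover have "?O \<subseteq> add x ` N"
  proof
    fix y assume y: "y \<in> ?O"
    then have "y = add x (add (neg x) y)" using add_neg_cancel x by simp
    then show "y \<in> add x ` N" using y W by blast
  qed
  ultimately show ?thesis using that by blast
qed

text \<open>The saturation of an open \<open>U\<close> is the union over \<open>k \<in> H\<close> of
  the preimages of \<open>U\<close> under right translation by \<open>k\<close>, so continuity of
  right translations suffices.\<close>

lemma open_map_left_coset: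
  assumes H: "strong_subgyrogroup (topspace T) add gyr H"
  shows "open_map T (coset_space T add H) (left_coset add H)"
  unfolding open_map_def
proof (intro allI impI)
  fix U assume U: "openin T U"
  have UG: "U \<subseteq> topspace T" using U openin_subset by blast
  have HG: "H \<subseteq> topspace T" using strong_subgyrogroup_subset[OF H] .
  have "left_coset add H y \<in> left_coset add H ` U \<longleftrightarrow> (\<exists>k\<in>H. add y k \<in> U)"
    if y: "y \<in> topspace T" for y
  proof -
    have "left_coset add H y \<in> left_coset add H ` U \<longleftrightarrow> (\<exists>u\<in>U. u \<in> left_coset add H y)"
      using left_coset_eq_iff[OF H y] UG by (simp add: image_iff) blast
    then show ?thesis by (auto simp: left_coset_def)
  qed
  then have "{y \<in> topspace T. left_coset add H y \<in> left_coset add H ` U} =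
      (\<Union>k\<in>H. {y \<in> topspace T. add y k \<in> U})" by blast
  moreover have "openin T \<dots>"
    using openin_continuous_map_preimage[OF continuous_add_right U] HG by blast
  ultimately show "openin (coset_space T add H) (left_coset add H ` U)"
    using UG by (auto simp: coset_space_def openin_quotient_topology)
qed

definition invariant_neighborhood :: "'a set \<Rightarrow> bool" where
  "invariant_neighborhood V \<longleftrightarrow> neighborhood T zero V \<and>
     (\<forall>x\<in>topspace T. \<forall>y\<in>topspace T. gyr x y ` V = V)"

lemma invariant_neighborhoodD:
  assumes "invariant_neighborhood V"
  shows "neighborhood T zero V" "V \<subseteq> topspace T" "zero \<in> V"
    "x \<in> topspace T \<Longrightarrow> y \<in> topspace T \<Longrightarrow> gyr x y ` V = V"
  using assms by (auto simp: invariant_neighborhood_def neighborhood_def)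

end

section \<open>Invariant neighborhoods as entourages of a uniformity\<close>

context strongly_topological_gyrogroup
begin

lemma invariant_neighborhood_subset:
  assumes "openin T N" "zero \<in> N"
  obtains V where "invariant_neighborhood V" "V \<subseteq> N"
proof -
  have "neighborhood T zero N"
    using assms openin_subset by (auto simp: neighborhood_def)
  then show ?thesis
    using gyr_invariant_base that
    unfolding neighborhood_base_def invariant_neighborhood_def by meson
qed

lemma invariant_neighborhood_Int:
  assumes "invariant_neighborhood V" "invariant_neighborhood W"
  obtains U where "invariant_neighborhood U" "U \<subseteq> V" "U \<subseteq> W"
proof -
  obtain A B where "openin T A" "zero \<in> A" "A \<subseteq> V" "openin T B" "zero \<in> B" "B \<subseteq> W"
    using assms by (auto simp: invariant_neighborhood_def neighborhood_def)
  then show ?thesis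
    using invariant_neighborhood_subset[of "A \<inter> B"] that by (metis openin_Int IntI le_inf_iff order_trans)
qed

lemma invariant_neighborhood_half:
  assumes V: "invariant_neighborhood V"
  obtains V' where "invariant_neighborhood V'" "V' \<subseteq> V"
    "\<And>v w. v \<in> V' \<Longrightarrow> w \<in> V' \<Longrightarrow> add v w \<in> V" "\<And>v. v \<in> V' \<Longrightarrow> neg v \<in> V"
proof -
  obtain A where A: "openin T A" "zero \<in> A" "A \<subseteq> V"
    using V by (auto simp: invariant_neighborhood_def neighborhood_def)
  let ?S = "{p \<in> topspace (prod_topology T T). (\<lambda>(x, y). add x y) p \<in> A}"
  have "openin (prod_topology T T) ?S"
    using openin_continuous_map_preimage[OF continuous_add A(1)] .
  moreover have "(zero, zero) \<in> ?S"
    using A zero_closed by (simp add: add_zero_left)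
  ultimately obtain B C where BC: "openin T B" "openin T C" "zero \<in> B" "zero \<in> C" "B \<times> C \<subseteq> ?S"
    by (simp only: openin_prod_topology_alt) meson
  let ?N = "{x \<in> topspace T. neg x \<in> A}"
  have N: "openin T ?N"
    using openin_continuous_map_preimage[OF continuous_neg A(1)] .
  have "neg zero = zero"
    using neg_unique[OF zero_closed zero_closed] add_zero_left[OF zero_closed] by simp
  then have N0: "zero \<in> ?N" using A zero_closed by simp
  obtain V' where V': "invariant_neighborhood V'" "V' \<subseteq> A \<inter> B \<inter> C \<inter> ?N"
    using invariant_neighborhood_subset[of "A \<inter> B \<inter> C \<inter> ?N"] A BC N N0
    by (metis (no_types, lifting) IntI openin_Int)
  show ?thesis
  proof (rule that[OF V'(1)])
    show "V' \<subseteq> V" using V' A by blast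
    show "add v w \<in> V" if "v \<in> V'" "w \<in> V'" for v w
    proof -
      have "(v, w) \<in> ?S" using that V'(2) BC(5) by blast
      then show ?thesis using A(3) by auto
    qed
    show "neg v \<in> V" if "v \<in> V'" for v using that V' A by blast
  qed
qed

text \<open>Composition and symmetry of the entourages. Invariance of \<open>V'\<close> absorbs the
  gyration when two steps are composed, and invariance of \<open>V\<close> absorbs it when a step is
  reversed.\<close>

lemma near_half:
  assumes V: "invariant_neighborhood V"
  obtains V' where "invariant_neighborhood V'" "V' \<subseteq> V"
    "\<And>x y z. x \<in> topspace T \<Longrightarrow> y \<in> add x ` V' \<Longrightarrow> z \<in> add y ` V' \<Longrightarrow> z \<in> add x ` V"
    "\<And>x y. x \<in> topspace T \<Longrightarrow> y \<in> add x ` V' \<Longrightarrow> x \<in> add y ` V"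
proof -
  obtain V' where V': "invariant_neighborhood V'" "V' \<subseteq> V"
    and sum: "\<And>v w. v \<in> V' \<Longrightarrow> w \<in> V' \<Longrightarrow> add v w \<in> V" and neg: "\<And>v. v \<in> V' \<Longrightarrow> neg v \<in> V"
    using invariant_neighborhood_half[OF V] by blast
  note inv = invariant_neighborhoodD[OF V] and inv' = invariant_neighborhoodD[OF V'(1)]
  show ?thesis
  proof (rule that[OF V'])
    fix x y z assume x: "x \<in> topspace T" and "y \<in> add x ` V'" "z \<in> add y ` V'"
    then obtain v w where v: "v \<in> V'" "w \<in> V'" "z = add (add x v) w" by blast
    have vG: "v \<in> topspace T" using v inv' by blast
    obtain w' where "w' \<in> V'" "z = add x (add v w')"
      using add_assoc_invariant[OF x vG inv'(2) inv'(4)[OF x vG] v(2)] v(3) by metis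
    then show "z \<in> add x ` V" using sum v by blast
  next
    fix x y assume x: "x \<in> topspace T" and "y \<in> add x ` V'"
    then obtain v where v: "v \<in> V'" "y = add x v" by blast
    have vG: "v \<in> topspace T" using v inv' by blast
    have "gyr x v (neg v) \<in> V" using inv(4)[OF x vG] neg[OF v(1)] by blast
    moreover have "add y (gyr x v (neg v)) = x"
      using gyr_assoc[OF x vG neg_closed[OF vG]] x vG v by (simp add: add_neg_right add_zero_right)
    ultimately show "x \<in> add y ` V" by (metis image_eqI)
  qed
qed

text \<open>Four \<open>V'\<close>-steps make one \<open>V\<close>-step. The first three may be
  taken in either direction, so one notion covers every chain of the main proof; shorter chains are
  padded by repeating a point.\<close>

definition quarter_entourage :: "'a set \<Rightarrow> 'a set \<Rightarrow> bool" where
  "quarter_entourage V' V \<longleftrightarrow>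
     (\<forall>a\<in>topspace T. \<forall>b\<in>topspace T. \<forall>c\<in>topspace T. \<forall>d\<in>topspace T. \<forall>e.
        (b \<in> add a ` V' \<or> a \<in> add b ` V') \<longrightarrow> (c \<in> add b ` V' \<or> b \<in> add c ` V') \<longrightarrow>
        (d \<in> add c ` V' \<or> c \<in> add d ` V') \<longrightarrow> e \<in> add d ` V' \<longrightarrow> e \<in> add a ` V)"

lemma quarter_entourageD:
  assumes "quarter_entourage V' V"
    and "a \<in> topspace T" "b \<in> topspace T" "c \<in> topspace T" "d \<in> topspace T"
    and "b \<in> add a ` V' \<or> a \<in> add b ` V'" "c \<in> add b ` V' \<or> b \<in> add c ` V'"
      "d \<in> add c ` V' \<or> c \<in> add d ` V'" "e \<in> add d ` V'"
  shows "e \<in> add a ` V"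
  using assms(1)[unfolded quarter_entourage_def, rule_format, OF assms(2-)] .

lemma quarter_entourage_exists:
  assumes V: "invariant_neighborhood V"
  obtains V' where "invariant_neighborhood V'" "quarter_entourage V' V"
proof -
  obtain V1 where V1: "invariant_neighborhood V1" "V1 \<subseteq> V"
    and t1: "\<And>x y z. x \<in> topspace T \<Longrightarrow> y \<in> add x ` V1 \<Longrightarrow> z \<in> add y ` V1 \<Longrightarrow> z \<in> add x ` V"
    and s1: "\<And>x y. x \<in> topspace T \<Longrightarrow> y \<in> add x ` V1 \<Longrightarrow> x \<in> add y ` V"
    by (fact near_half[OF V])
  obtain V2 where V2: "invariant_neighborhood V2" "V2 \<subseteq> V1"
    and t2: "\<And>x y z. x \<in> topspace T \<Longrightarrow> y \<in> add x ` V2 \<Longrightarrow> z \<in> add y ` V2 \<Longrightarrow> z \<in> add x ` V1"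
    and s2: "\<And>x y. x \<in> topspace T \<Longrightarrow> y \<in> add x ` V2 \<Longrightarrow> x \<in> add y ` V1"
    by (fact near_half[OF V1(1)])
  obtain V3 where V3: "invariant_neighborhood V3" "V3 \<subseteq> V2"
    and t3: "\<And>x y z. x \<in> topspace T \<Longrightarrow> y \<in> add x ` V3 \<Longrightarrow> z \<in> add y ` V3 \<Longrightarrow> z \<in> add x ` V2"
    and s3: "\<And>x y. x \<in> topspace T \<Longrightarrow> y \<in> add x ` V3 \<Longrightarrow> x \<in> add y ` V2"
    by (fact near_half[OF V2(1)])
  show ?thesis
  proof (rule that[OF V3(1)], unfold quarter_entourage_def, intro ballI allI impI)
    \<comment> \<open>The passage from \<open>V3\<close> to \<open>V2\<close> pays for the direction
      of a step; \<open>V2\<close> to \<open>V1\<close> and \<open>V1\<close> to \<open>V\<close>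
      each double the number of steps.\<close>
    have sym: "y \<in> add x ` V2"
      if "x \<in> topspace T" "y \<in> topspace T" "y \<in> add x ` V3 \<or> x \<in> add y ` V3" for x y
      using that s3 V3(2) by blast
    fix a b c d e
    assume G: "a \<in> topspace T" "b \<in> topspace T" "c \<in> topspace T" "d \<in> topspace T"
      and "b \<in> add a ` V3 \<or> a \<in> add b ` V3" "c \<in> add b ` V3 \<or> b \<in> add c ` V3"
        "d \<in> add c ` V3 \<or> c \<in> add d ` V3" "e \<in> add d ` V3"
    then have "b \<in> add a ` V2" "c \<in> add b ` V2" "d \<in> add c ` V2" "e \<in> add d ` V2"
      using sym V3(2) by blast+
    then have "c \<in> add a ` V1" "e \<in> add c ` V1" using t2 G by blast+
    then show "e \<in> add a ` V" using t1 G by blast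
  qed
qed

text \<open>Each basic open set of \<open>H\<close> at \<open>zero\<close> is the trace of an open
  set of \<open>G\<close>, and an invariant neighborhood fits inside the latter. Only traces on
  \<open>H\<close> become small: the members themselves need not form a base of \<open>G\<close> at
  \<open>zero\<close>.\<close>

lemma countable_invariant_trace_base:
  assumes HG: "H \<subseteq> topspace T" and H0: "zero \<in> H" and fc: "first_countable (subtopology T H)"
  obtains \<V> where "countable \<V>" "\<And>V. V \<in> \<V> \<Longrightarrow> invariant_neighborhood V"
    "\<And>W. invariant_neighborhood W \<Longrightarrow> \<exists>V\<in>\<V>. V \<inter> H \<subseteq> W"
proof -
  have "zero \<in> topspace (subtopology T H)" using H0 HG by auto
  then obtain \<B> where \<B>: "countable \<B>" "\<And>B. B \<in> \<B> \<Longrightarrow> openin (subtopology T H) B"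
    "\<And>U. openin (subtopology T H) U \<Longrightarrow> zero \<in> U \<Longrightarrow> \<exists>B\<in>\<B>. zero \<in> B \<and> B \<subseteq> U"
    using fc unfolding first_countable_def by metis
  have "\<exists>V. invariant_neighborhood V \<and> V \<inter> H \<subseteq> B" if B: "B \<in> \<B>" "zero \<in> B" for B
  proof -
    obtain A where A: "openin T A" "B = A \<inter> H"
      using \<B>(2)[OF B(1)] by (auto simp: openin_subtopology)
    then obtain V where "invariant_neighborhood V" "V \<subseteq> A"
      using invariant_neighborhood_subset[of A] B by blast
    then show ?thesis using A by blast
  qed
  then obtain f where f: "\<And>B. B \<in> \<B> \<Longrightarrow> zero \<in> B \<Longrightarrow> invariant_neighborhood (f B) \<and> f B \<inter> H \<subseteq> B"
    by metis
  show ?thesis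
  proof (rule that)
    show "countable (f ` {B \<in> \<B>. zero \<in> B})" using \<B>(1) by simp
    show "invariant_neighborhood V" if "V \<in> f ` {B \<in> \<B>. zero \<in> B}" for V
      using that f by blast
    fix W assume "invariant_neighborhood W"
    then obtain A where A: "openin T A" "zero \<in> A" "A \<subseteq> W"
      by (auto simp: invariant_neighborhood_def neighborhood_def)
    then have "openin (subtopology T H) (A \<inter> H)" "zero \<in> A \<inter> H"
      using H0 by (auto simp: openin_subtopology_Int)
    then obtain B where "B \<in> \<B>" "zero \<in> B" "B \<subseteq> A \<inter> H" using \<B>(3) by blast
    then show "\<exists>V\<in>f ` {B \<in> \<B>. zero \<in> B}. V \<inter> H \<subseteq> W" using f A by blast
  qed
qed

text \<open>Left translation by \<open>a\<close> carries \<open>D\<close> to a dense part of the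
  coset of \<open>a\<close>: if \<open>b = add a h\<close> and \<open>d = add h v\<close>, then
  \<open>add a d = add b (gyr a h v)\<close>, and invariance keeps the last term in
  \<open>V\<close>.\<close>

lemma dense_translate_near:
  assumes H: "strong_subgyrogroup (topspace T) add gyr H"
    and D: "D \<subseteq> H" "H \<subseteq> subtopology T H closure_of D"
    and V: "invariant_neighborhood V" and a: "a \<in> topspace T" and b: "b \<in> left_coset add H a"
  obtains d where "d \<in> D" "add a d \<in> add b ` V"
proof -
  have HG: "H \<subseteq> topspace T" using strong_subgyrogroup_subset[OF H] .
  obtain h where h: "h \<in> H" "b = add a h" using b by (auto simp: left_coset_def)
  have hG: "h \<in> topspace T" using h HG by blast
  obtain A where A: "openin T A" "h \<in> A" "A \<subseteq> add h ` V"
    using neighborhood_preimage_left_translation[OF hG invariant_neighborhoodD(1)[OF V]] by blast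
  have "h \<in> subtopology T H closure_of D" using D(2) h(1) by blast
  moreover have "openin (subtopology T H) (A \<inter> H)" "h \<in> A \<inter> H"
    using A h by (auto simp: openin_subtopology_Int)
  ultimately obtain d where d: "d \<in> D" "d \<in> A \<inter> H"
    unfolding in_closure_of by blast
  then obtain v where v: "v \<in> V" "d = add h v" using A by blast
  have "add a d = add b (gyr a h v)"
    using gyr_assoc[OF a hG, of v] v h invariant_neighborhoodD(2)[OF V] by auto
  moreover have "gyr a h v \<in> V"
    using invariant_neighborhoodD(4)[OF V a hG] v(1) by blast
  ultimately show ?thesis using that d by blast
qed

end

text \<open>Pieces can meet only over members of \<open>\<P>\<close> that meet; a given member meets
  countably many others, each with countably many pieces.\<close>

lemma star_countable_countable_pieces:
  assumes P: "star_countable \<P>" and I: "countable I"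
    and sub: "\<And>P i. P \<in> \<P> \<Longrightarrow> i \<in> I \<Longrightarrow> S P i \<subseteq> f -` P"
  shows "star_countable {S P i |P i. P \<in> \<P> \<and> i \<in> I}"
  unfolding star_countable_def
proof
  fix A assume "A \<in> {S P i |P i. P \<in> \<P> \<and> i \<in> I}"
  then obtain P i where A: "P \<in> \<P>" "i \<in> I" "A = S P i" by blast
  let ?Q = "{Q \<in> {S P i |P i. P \<in> \<P> \<and> i \<in> I}. A \<inter> Q \<noteq> {}}"
  have "?Q \<subseteq> (\<lambda>(P, i). S P i) ` ({Q \<in> \<P>. P \<inter> Q \<noteq> {}} \<times> I)"
  proof
    fix Q assume "Q \<in> ?Q"
    then obtain P' j where Q: "P' \<in> \<P>" "j \<in> I" "Q = S P' j" "A \<inter> Q \<noteq> {}" by blast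
    then have "P \<inter> P' \<noteq> {}" using sub[OF A(1,2)] sub[OF Q(1,2)] A(3) by blast
    then show "Q \<in> (\<lambda>(P, i). S P i) ` ({Q \<in> \<P>. P \<inter> Q \<noteq> {}} \<times> I)" using Q by auto
  qed
  moreover have "countable \<dots>"
    using P A(1) I by (auto simp: star_countable_def)
  ultimately show "countable ?Q" by (rule countable_subset)
qed

section \<open>Lifting the network from the coset space\<close>

theorem theorem6p11:
  fixes T :: "'a topology"
    and add :: "'a \<Rightarrow> 'a \<Rightarrow> 'a"
    and zero :: 'a
    and neg :: "'a \<Rightarrow> 'a"
    and gyr :: "'a \<Rightarrow> 'a \<Rightarrow> 'a \<Rightarrow> 'a"
    and H :: "'a set"
  assumes "strongly_topological_gyrogroup T add zero neg gyr"
    and "strong_subgyrogroup (topspace T) add gyr H"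
    and "closedin T H"
    and "first_countable (subtopology T H)"
    and "separable_space (subtopology T H)"
    and "\<exists>\<P>. wcs_star_network (coset_space T add H) \<P> \<and> star_countable \<P>"
  shows "\<exists>\<P>. wcs_star_network T \<P> \<and> star_countable \<P>"
proof -
  interpret strongly_topological_gyrogroup T add zero neg gyr by (fact assms(1))
  note H = assms(2)
  note HG = strong_subgyrogroup_subset[OF H]
  let ?\<pi> = "left_coset add H" and ?Q = "coset_space T add H"
  have H0: "zero \<in> H" using zero_mem_subgyrogroup[OF subgyrogroup_of_strong[OF H]] .
  have cont: "continuous_map T ?Q ?\<pi>"
    unfolding coset_space_def by (intro quotient_imp_continuous_map quotient_map_quotient_topology)
  have topQ: "topspace ?Q = ?\<pi> ` topspace T"
    by (simp add: coset_space_def topspace_quotient_topology)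
  obtain D where D: "countable D" "D \<subseteq> H" "H \<subseteq> subtopology T H closure_of D"
    using assms(5) HG unfolding separable_space_def by auto
  obtain \<V> where \<V>: "countable \<V>" "\<And>V. V \<in> \<V> \<Longrightarrow> invariant_neighborhood V"
    "\<And>W. invariant_neighborhood W \<Longrightarrow> \<exists>V\<in>\<V>. V \<inter> H \<subseteq> W"
    using countable_invariant_trace_base[OF HG H0 assms(4)] by blast
  have "\<exists>V'. invariant_neighborhood V' \<and> quarter_entourage V' V" if V: "V \<in> \<V>" for V
    using quarter_entourage_exists[OF \<V>(2)[OF V]] by blast
  \<comment> \<open>One refinement \<open>q V\<close> is fixed per \<open>V\<close>, before any
    sequence is given, so that \<open>D \<times> \<V>\<close> remains a countable index set.\<close>
  then obtain q where q: "\<And>V. V \<in> \<V> \<Longrightarrow> invariant_neighborhood (q V) \<and> quarter_entourage (q V) V"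
    by metis
  obtain \<P> where \<P>: "wcs_star_network ?Q \<P>" "star_countable \<P>" using assms(6) by blast
  have "\<exists>a. a \<in> topspace T \<and> ?\<pi> a \<in> P" if "P \<in> \<P>" "P \<noteq> {}" for P
  proof -
    have "P \<subseteq> ?\<pi> ` topspace T"
      using \<P>(1) that(1) unfolding wcs_star_network_def topQ by blast
    then show ?thesis using that(2) by blast
  qed
  \<comment> \<open>For empty \<open>P\<close> the value of \<open>rep P\<close> is arbitrary, but
    the pieces over \<open>P\<close> are then empty.\<close>
  then obtain rep where rep: "\<And>P. P \<in> \<P> \<Longrightarrow> P \<noteq> {} \<Longrightarrow> rep P \<in> topspace T \<and> ?\<pi> (rep P) \<in> P"
    by metis
  define S where
    "S P i = {y \<in> topspace T. ?\<pi> y \<in> P \<and> y \<in> add (add (rep P) (fst i)) ` q (snd i)}" for P i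
  let ?F = "{S P i |P i. P \<in> \<P> \<and> i \<in> D \<times> \<V>}"
  have "star_countable ?F"
    by (rule star_countable_countable_pieces[OF \<P>(2), where f = ?\<pi>]) (use D(1) \<V>(1) in \<open>auto simp: S_def\<close>)
  moreover have "wcs_star_network T ?F"
    unfolding wcs_star_network_def
  proof (intro conjI allI impI)
    show "\<forall>P\<in>?F. P \<subseteq> topspace T" by (auto simp: S_def)
    fix s x U
    assume s: "range s \<subseteq> topspace T" and lim: "limitin T s x sequentially"
      and U: "neighborhood T x U"
    have x: "x \<in> topspace T" using lim by (simp add: limitin_def)
    obtain A where A: "openin T A" "x \<in> A" "A \<subseteq> U" using U by (auto simp: neighborhood_def)
    obtain W where W: "invariant_neighborhood W" "W \<subseteq> {w \<in> topspace T. add x w \<in> A}"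
      using invariant_neighborhood_subset[OF openin_continuous_map_preimage[OF continuous_add_left[OF x] A(1)]]
        A x zero_closed add_zero_right by auto
    have xx: "x \<in> add x ` V" if V: "invariant_neighborhood V" for V
      using invariant_neighborhoodD(3)[OF V] add_zero_right[OF x] by (metis image_eqI)
    obtain W2 where W2: "invariant_neighborhood W2" "quarter_entourage W2 W"
      using quarter_entourage_exists[OF W(1)] by blast
    \<comment> \<open>\<open>V\<close> itself may be large; it will be applied only to differences
      lying in \<open>H\<close>.\<close>
    obtain V where V: "V \<in> \<V>" "V \<inter> H \<subseteq> W2" using \<V>(3)[OF W2(1)] by blast
    have qV: "invariant_neighborhood (q V)" "quarter_entourage (q V) V" using q V(1) by blast+
    obtain V1 where V1: "invariant_neighborhood V1" "quarter_entourage V1 (q V)"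
      using quarter_entourage_exists[OF qV(1)] by blast
    obtain V0 where V0: "invariant_neighborhood V0" "V0 \<subseteq> V1" "V0 \<subseteq> W2"
      using invariant_neighborhood_Int[OF V1(1) W2(1)] by blast
    \<comment> \<open>\<open>V2\<close> lies in \<open>V1\<close> to capture the sequence, and in
      \<open>q V\<close> and \<open>W2\<close> to keep the captured set inside
      \<open>U\<close>.\<close>
    obtain V2 where V2: "invariant_neighborhood V2" "V2 \<subseteq> V0" "V2 \<subseteq> q V"
      using invariant_neighborhood_Int[OF V0(1) qV(1)] by blast
    obtain B where B: "openin T B" "x \<in> B" "B \<subseteq> add x ` V2"
      using neighborhood_preimage_left_translation[OF x invariant_neighborhoodD(1)[OF V2(1)]] by blast
    obtain N where N: "\<And>n. n \<ge> N \<Longrightarrow> s n \<in> B"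
      using lim B unfolding limitin_sequentially by blast
    \<comment> \<open>The network picks its subsequence freely, so the terms outside
      \<open>B\<close> are dropped beforehand; the shift by \<open>N\<close> returns in the final
      subsequence.\<close>
    define t where "t = (\<lambda>n. s (n + N))"
    have "limitin T t x sequentially"
      unfolding t_def using lim by (rule limitin_sequentially_offset)
    then have "limitin ?Q (?\<pi> \<circ> t) (?\<pi> x) sequentially"
      using continuous_map_limit[OF cont] by blast
    moreover have "range (?\<pi> \<circ> t) \<subseteq> topspace ?Q" using s by (auto simp: topQ t_def)
    moreover have "neighborhood ?Q (?\<pi> x) (?\<pi> ` B)"
    proof -
      have "openin ?Q (?\<pi> ` B)"
        using open_map_left_coset[OF H] B(1) by (simp add: open_map_def)
      then show ?thesis
        using B(2) openin_subset unfolding neighborhood_def by (metis image_eqI order_refl)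
    qed
    ultimately have "\<exists>r :: nat \<Rightarrow> nat. strict_mono r \<and>
        (\<exists>P\<in>\<P>. range ((?\<pi> \<circ> t) \<circ> r) \<subseteq> P \<and> P \<subseteq> ?\<pi> ` B)"
      using \<P>(1) by (simp only: wcs_star_network_def)
    then obtain r :: "nat \<Rightarrow> nat" and P
      where r: "strict_mono r" and P: "P \<in> \<P>" "range ((?\<pi> \<circ> t) \<circ> r) \<subseteq> P" "P \<subseteq> ?\<pi> ` B"
      by (elim exE conjE bexE)
    \<comment> \<open>A point over \<open>P\<close> may be far from \<open>x\<close>, but its coset
      contains a point \<open>b\<close> close to \<open>x\<close>.\<close>
    have over: "\<exists>b. b \<in> topspace T \<and> b \<in> add x ` V2 \<and> y \<in> ?\<pi> b"
      if y: "y \<in> topspace T" "?\<pi> y \<in> P" for y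
    proof -
      obtain b where "b \<in> B" "?\<pi> y = ?\<pi> b" using P(3) y(2) by blast
      moreover have "y \<in> ?\<pi> y" by (rule left_coset_self[OF H y(1)])
      ultimately show ?thesis using B(3) openin_subset[OF B(1)] by auto
    qed
    have "P \<noteq> {}" using P(2) by auto
    then have a: "rep P \<in> topspace T" "?\<pi> (rep P) \<in> P" using rep[OF P(1)] by simp_all
    obtain b where b: "b \<in> topspace T" "b \<in> add x ` V2" "rep P \<in> ?\<pi> b" using over[OF a] by blast
    have "b \<in> ?\<pi> (rep P)" by (rule left_coset_sym[OF H b(1,3)])
    then obtain d where d: "d \<in> D" "add (rep P) d \<in> add b ` V2"
      by (rule dense_translate_near[OF H D(2,3) V2(1) a(1)])
    define c where "c = add (rep P) d"
    have c: "c \<in> topspace T" "c \<in> add b ` V2"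
      using d a D(2) HG add_closed by (auto simp: c_def)
    have V21: "V2 \<subseteq> V1" using V2 V0 by blast
    have S: "S P (d, V) = {y \<in> topspace T. ?\<pi> y \<in> P \<and> y \<in> add c ` q V}"
      by (simp add: S_def c_def)
    have "t n \<in> add c ` q V" for n
    proof -
      have tn: "t n \<in> add x ` V1" using N[of "n + N"] B(3) V21 by (auto simp: t_def)
      show ?thesis
        \<comment> \<open>The chain is \<open>c\<close>, \<open>b\<close>, \<open>x\<close>,
          \<open>x\<close>, \<open>t n\<close>, its first two steps taken backwards.\<close>
        using quarter_entourageD[OF V1(2) c(1) b(1) x x _ _ _ tn] xx[OF V1(1)] b(2) c(2) V21 by blast
    qed
    then have "range (t \<circ> r) \<subseteq> S P (d, V)"
      using P(2) s unfolding S by (auto simp: t_def)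
    moreover have "S P (d, V) \<subseteq> U"
    proof
      fix y assume "y \<in> S P (d, V)"
      then have y: "y \<in> topspace T" "?\<pi> y \<in> P" "y \<in> add c ` q V" unfolding S by auto
      obtain e where e: "e \<in> topspace T" "e \<in> add x ` V2" "y \<in> ?\<pi> e" using over[OF y(1,2)] by blast
      then have "e \<in> add x ` q V" "b \<in> add x ` q V" "c \<in> add b ` q V"
        using b(2) c(2) V2(3) by blast+
      \<comment> \<open>The chain is \<open>e\<close>, \<open>x\<close>, \<open>b\<close>,
        \<open>c\<close>, \<open>y\<close>. It starts at \<open>e\<close> rather than
        \<open>x\<close> because \<open>e\<close> shares its coset with \<open>y\<close>.\<close>
      then have "y \<in> add e ` V"
        using quarter_entourageD[OF qV(2) e(1) x b(1) c(1) _ _ _ y(3)] by blast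
      then obtain v where v: "v \<in> V" "y = add e v" by blast
      obtain h where h: "h \<in> H" "y = add e h" using e(3) by (auto simp: left_coset_def)
      have "v \<in> topspace T" using v invariant_neighborhoodD(2)[OF \<V>(2)[OF V(1)]] by blast
      \<comment> \<open>Cancelling \<open>e\<close> puts the difference \<open>v\<close> into
        \<open>V \<inter> H\<close>, where the trace condition makes it small.\<close>
      then have "h = v" using add_left_inj[OF e(1)] h v HG by blast
      then have "y \<in> add e ` W2" using V(2) v h by blast
      then have "y \<in> add x ` W"
        using quarter_entourageD[OF W2(2) x x x e(1)] xx[OF W2(1)] e(2) V2(2) V0(3) by blast
      then show "y \<in> U" using W(2) A(3) by blast
    qed
    moreover have "S P (d, V) \<in> ?F" using P(1) d(1) V(1) by blast
    moreover have "t \<circ> r = s \<circ> (\<lambda>n. r n + N)" by (simp add: t_def o_def)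
    ultimately have "\<exists>P\<in>?F. range (s \<circ> (\<lambda>n. r n + N)) \<subseteq> P \<and> P \<subseteq> U"
      by (intro bexI[of _ "S P (d, V)"] conjI) simp_all
    moreover have "strict_mono (\<lambda>n. r n + N)" using r by (simp add: strict_mono_def)
    ultimately show "\<exists>r :: nat \<Rightarrow> nat. strict_mono r \<and> (\<exists>P\<in>?F. range (s \<circ> r) \<subseteq> P \<and> P \<subseteq> U)"
      by (intro exI conjI)
  qed
  ultimately show ?thesis by blast
qed

end
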